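(* Let $S$ be a semiring. Then $S$ is exact if and only if the following two conditions hold for all positive integers $m,n$ and all $A\in S^{m\times n}$. (F1) For every positive integer $p$ and every $B\in S^{p\times n}$, if $\operatorname{Ker}\operatorname{Row}(A)\subseteq\operatorname{Ker}\operatorname{Row}(B)$ then $\operatorname{Row}(B)\subseteq\operatorname{Row}(A)$. (F2) For every positive integer $q$ and every $B\in S^{m\times q}$, if $\operatorname{Ker}\operatorname{Col}(A)\subseteq\operatorname{Ker}\operatorname{Col}(B)$ then $\operatorname{Col}(B)\subseteq\operatorname{Col}(A)$.
   Context: A semiring is a set $S$ with a commutative associative addition and an associative (not necessarily commutative) multiplication distributing over addition from both sides, such that for every non-empty finite subset $L\subseteq S$ there are local identities $0_L,1_L\in S$ with $a+0_Lb=1_La=a$ and $a+b0_L=a1_L=a$ for all $a,b\in L$. (No global zero or identity is required.) $S^{m\times n}$ is the set of $m\times n$ matrices over $S$, with the usual matrix addition and multiplication. For $A\in S^{m\times n}$, $\operatorname{Row}(A)=\{uA: u\in S^{1\times m}\}\subseteq S^{1\times n}$ and $\operatorname{Col}(A)=\{Av: v\in S^{n\times 1}\}\subseteq S^{m\times 1}$. For $X\subseteq S^{1\times n}$, $\operatorname{Ker}(X)=\{(v,v')\in S^{n\times 1}\times S^{n\times 1}: xv=xv'\text{ for all }x\in X\}$. For $Y\subseteq S^{m\times 1}$, $\operatorname{Ker}(Y)=\{(u,u')\in S^{1\times m}\times S^{1\times m}: uy=u'y\text{ for all }y\in Y\}$. $S$ is exact if for all positive integers $m,n$ and all $A\in S^{m\times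 n}$: (E1) if $x\in S^{1\times n}\setminus\operatorname{Row}(A)$ then there are $v,v'\in S^{n\times 1}$ with $Av=Av'$ but $xv\neq xv'$; and (E2) if $y\in S^{m\times 1}\setminus\operatorname{Col}(A)$ then there are $u,u'\in S^{1\times m}$ with $uA=u'A$ but $uy\neq u'y$. *)

theory Defs
  imports "Jordan_Normal_Form.Matrix"
begin

text \<open>The library class \<open>semiring\<close> has neither a zero nor a one: it asks for a commutative
  associative addition and an associative multiplication with both distributive laws.\<close>

class local_identity_semiring = semiring +
  assumes local_identities:
    "\<lbrakk>finite L; L \<noteq> {}\<rbrakk> \<Longrightarrow>
       \<exists>z e. \<forall>a\<in>L. \<forall>b\<in>L. a + z * b = a \<and> e * a = a \<and> a + b * z = a \<and> a * e = a"

text \<open>Without a zero there is no empty sum, so \<open>sum\<close> and the library product of matrices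
  (which needs \<open>semiring_0\<close>) do not apply. \<open>sum_up_to f n\<close> is
  \<open>f 0 + \<dots> + f n\<close>, both ends included.\<close>

primrec sum_up_to :: "(nat \<Rightarrow> 'a::ab_semigroup_add) \<Rightarrow> nat \<Rightarrow> 'a" where
  "sum_up_to f 0 = f 0"
| "sum_up_to f (Suc n) = sum_up_to f n + f (Suc n)"

text \<open>Meaningful when \<open>dim_col A = dim_row B\<close> is positive; entries are indexed from \<open>0\<close>.\<close>

definition mat_prod :: "'a::semiring mat \<Rightarrow> 'a mat \<Rightarrow> 'a mat" (infixl "\<star>" 70) where
  "A \<star> B = mat (dim_row A) (dim_col B)
     (\<lambda>(i, j). sum_up_to (\<lambda>k. A $$ (i, k) * B $$ (k, j)) (dim_col A - 1))"

definition Row :: "'a::semiring mat \<Rightarrow> 'a mat set" where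
  "Row A = {u \<star> A | u. u \<in> carrier_mat 1 (dim_row A)}"

definition Col :: "'a::semiring mat \<Rightarrow> 'a mat set" where
  "Col A = {A \<star> v | v. v \<in> carrier_mat (dim_col A) 1}"

text \<open>\<open>Ker\<close> of a set of rows of length \<open>n\<close>, and of a set of columns of length \<open>m\<close>. The length is
  an argument because the set alone does not determine it (it may be empty).\<close>

definition Ker_rows :: "nat \<Rightarrow> 'a::semiring mat set \<Rightarrow> ('a mat \<times> 'a mat) set" where
  "Ker_rows n X = {(v, v'). v \<in> carrier_mat n 1 \<and> v' \<in> carrier_mat n 1 \<and>
     (\<forall>x\<in>X. x \<star> v = x \<star> v')}"

definition Ker_cols :: "nat \<Rightarrow> 'a::semiring mat set \<Rightarrow> ('a mat \<times> 'a mat) set" where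
  "Ker_cols m Y = {(u, u'). u \<in> carrier_mat 1 m \<and> u' \<in> carrier_mat 1 m \<and>
     (\<forall>y\<in>Y. u \<star> y = u' \<star> y)}"

definition exact :: "'a::local_identity_semiring itself \<Rightarrow> bool" where
  "exact (_ :: 'a itself) \<longleftrightarrow>
     (\<forall>m>0. \<forall>n>0. \<forall>A \<in> (carrier_mat m n :: 'a mat set).
        (\<forall>x \<in> carrier_mat 1 n - Row A.
           \<exists>v \<in> carrier_mat n 1. \<exists>v' \<in> carrier_mat n 1. A \<star> v = A \<star> v' \<and> x \<star> v \<noteq> x \<star> v') \<and>
        (\<forall>y \<in> carrier_mat m 1 - Col A.
           \<exists>u \<in> carrier_mat 1 m. \<exists>u' \<in> carrier_mat 1 m. u \<star> A = u' \<star> A \<and> u \<star> y \<noteq> u' \<star> y))"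

end

theory Submission imports Defs begin

text \<open>Two facts carry the proof. Multiplication of matrices is associative, so \<open>A \<star> v = A \<star> v'\<close>
  implies that every row in \<open>Row A\<close> takes the same value on \<open>v\<close> and \<open>v'\<close>. Conversely, local
  identities make each row of \<open>A\<close> a member of \<open>Row A\<close>: multiply \<open>A\<close> from the left by the row that
  has a local one at position \<open>i\<close> and a local zero elsewhere. Hence \<open>Ker_rows n (Row A)\<close> is exactly
  the set of pairs \<open>(v, v')\<close> with \<open>A \<star> v = A \<star> v'\<close>, and a single row \<open>x\<close> lies in \<open>Row x\<close>.

  Given exactness, a row in \<open>Row B\<close> outside \<open>Row A\<close> would be separated from \<open>A\<close> by a pair in
  \<open>Ker_rows n (Row A)\<close>, which the inclusion of kernels excludes. Given the kernel condition, apply it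
  with \<open>B\<close> the single row \<open>x\<close>: if \<open>x\<close> is not in \<open>Row A\<close>, then \<open>Row x\<close> is not contained in
  \<open>Row A\<close>, so some pair in the kernel of \<open>A\<close> is not in the kernel of \<open>x\<close>, and it separates \<open>x\<close>
  from \<open>A\<close>. The argument for columns is dual; each side of exactness is matched with its own
  kernel condition, one matrix \<open>A\<close> at a time.\<close>

section \<open>Non-empty sums and associativity of the matrix product\<close>

lemma sum_up_to_cong:
  "(\<And>k. k \<le> n \<Longrightarrow> f k = g k) \<Longrightarrow> sum_up_to f n = sum_up_to g n"
  by (induction n) auto

lemma sum_up_to_add:
  "sum_up_to (\<lambda>k. f k + g k) n = sum_up_to f n + sum_up_to g n"
  by (induction n) (simp_all add: ac_simps)

lemma sum_up_to_swap:
  "sum_up_to (\<lambda>k. sum_up_to (f k) m) n = sum_up_to (\<lambda>l. sum_up_to (\<lambda>k. f k l) n) m"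
  by (induction n) (simp_all add: sum_up_to_add)

lemma sum_up_to_distrib_left:
  fixes c :: "'a::semiring"
  shows "c * sum_up_to f n = sum_up_to (\<lambda>k. c * f k) n"
  by (induction n) (simp_all add: distrib_left)

lemma sum_up_to_distrib_right:
  fixes c :: "'a::semiring"
  shows "sum_up_to f n * c = sum_up_to (\<lambda>k. f k * c) n"
  by (induction n) (simp_all add: distrib_right)

lemma add_sum_up_to_absorb:
  "(\<And>k. k \<le> n \<Longrightarrow> a + f k = a) \<Longrightarrow> a + sum_up_to f n = a"
  by (induction n) (simp_all add: add.assoc [symmetric])

text \<open>Without a global zero, ``all other summands vanish'' means that they are absorbed by the
  remaining one.\<close>

lemma sum_up_to_eq_single:
  "\<lbrakk>i \<le> n; \<And>k. k \<le> n \<Longrightarrow> k \<noteq> i \<Longrightarrow> f i + f k = f i\<rbrakk> \<Longrightarrow> sum_up_to f n = f i"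
proof (induction n)
  case (Suc n)
  show ?case
  proof (cases "i = Suc n")
    case True
    have "f i + sum_up_to f n = f i"
      using Suc.prems True by (intro add_sum_up_to_absorb) auto
    then show ?thesis using True by (simp add: add.commute)
  next
    case False
    then show ?thesis using Suc by simp
  qed
qed simp

lemma mat_prod_carrier [simp]:
  "\<lbrakk>A \<in> carrier_mat m n; B \<in> carrier_mat n p\<rbrakk> \<Longrightarrow> A \<star> B \<in> carrier_mat m p"
  by (auto simp: mat_prod_def)

lemma mat_prod_index:
  "\<lbrakk>i < dim_row A; j < dim_col B\<rbrakk> \<Longrightarrow>
     (A \<star> B) $$ (i, j) = sum_up_to (\<lambda>k. A $$ (i, k) * B $$ (k, j)) (dim_col A - 1)"
  by (simp add: mat_prod_def)

lemma mat_prod_assoc: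
  assumes A: "A \<in> carrier_mat m n" and B: "B \<in> carrier_mat n p" and C: "C \<in> carrier_mat p q"
    and "n > 0" and "p > 0"
  shows "(A \<star> B) \<star> C = A \<star> (B \<star> C)"
proof (rule eq_matI)
  fix i j assume "i < dim_row (A \<star> (B \<star> C))" and "j < dim_col (A \<star> (B \<star> C))"
  then have ij: "i < m" "j < q" using A C by (auto simp: mat_prod_def)
  have "((A \<star> B) \<star> C) $$ (i, j) =
      sum_up_to (\<lambda>l. (A \<star> B) $$ (i, l) * C $$ (l, j)) (p - 1)"
    using A B C ij by (subst mat_prod_index) (auto simp: mat_prod_def)
  also have "\<dots> = sum_up_to (\<lambda>l. sum_up_to
      (\<lambda>k. A $$ (i, k) * (B $$ (k, l) * C $$ (l, j))) (n - 1)) (p - 1)"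
    using A B ij \<open>p > 0\<close>
    by (intro sum_up_to_cong) (simp add: mat_prod_index sum_up_to_distrib_right mult.assoc)
  also have "\<dots> = sum_up_to (\<lambda>k. sum_up_to
      (\<lambda>l. A $$ (i, k) * (B $$ (k, l) * C $$ (l, j))) (p - 1)) (n - 1)"
    by (rule sum_up_to_swap)
  also have "\<dots> = sum_up_to (\<lambda>k. A $$ (i, k) * (B \<star> C) $$ (k, j)) (n - 1)"
    using B C ij \<open>n > 0\<close>
    by (intro sum_up_to_cong) (simp add: mat_prod_index sum_up_to_distrib_left)
  also have "\<dots> = (A \<star> (B \<star> C)) $$ (i, j)"
    using A B C ij by (subst mat_prod_index) (auto simp: mat_prod_def)
  finally show "((A \<star> B) \<star> C) $$ (i, j) = (A \<star> (B \<star> C)) $$ (i, j)" .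
qed (auto simp: mat_prod_def)

section \<open>Rows and columns of a matrix lie in its row and column space\<close>

text \<open>One local zero and one local identity for the finite set of all entries of \<open>A\<close>.\<close>

lemma mat_local_identities:
  fixes A :: "'a::local_identity_semiring mat"
  assumes "A \<in> carrier_mat m n" "m > 0" "n > 0"
  obtains z e where
    "\<And>i j k l. i < m \<Longrightarrow> j < n \<Longrightarrow> k < m \<Longrightarrow> l < n \<Longrightarrow>
       A $$ (i, j) + z * A $$ (k, l) = A $$ (i, j) \<and> e * A $$ (i, j) = A $$ (i, j) \<and>
       A $$ (i, j) + A $$ (k, l) * z = A $$ (i, j) \<and> A $$ (i, j) * e = A $$ (i, j)"
proof -
  define L where "L = (\<lambda>ij. A $$ ij) ` ({..<m} \<times> {..<n})"
  have "finite L" "L \<noteq> {}" using assms by (auto simp: L_def)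
  from local_identities [OF this] obtain z e where
    "\<forall>a\<in>L. \<forall>b\<in>L. a + z * b = a \<and> e * a = a \<and> a + b * z = a \<and> a * e = a"
    by blast
  moreover have "A $$ (i, j) \<in> L" if "i < m" "j < n" for i j
    using that by (auto simp: L_def)
  ultimately show thesis by (intro that) blast
qed

lemma row_in_Row:
  fixes A :: "'a::local_identity_semiring mat"
  assumes A: "A \<in> carrier_mat m n" and "n > 0" and i: "i < m"
  shows "mat 1 n (\<lambda>(_, j). A $$ (i, j)) \<in> Row A"
proof -
  from i have "m > 0" by simp
  from mat_local_identities [OF A this \<open>n > 0\<close>] obtain z e where ze:
    "\<And>i j k l. i < m \<Longrightarrow> j < n \<Longrightarrow> k < m \<Longrightarrow> l < n \<Longrightarrow>
       A $$ (i, j) + z * A $$ (k, l) = A $$ (i, j) \<and> e * A $$ (i, j) = A $$ (i, j)"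
    by metis
  define u where "u = mat 1 m (\<lambda>(_, k). if k = i then e else z)"
  have "mat 1 n (\<lambda>(_, j). A $$ (i, j)) = u \<star> A"
  proof (rule eq_matI)
    fix r j assume "r < dim_row (u \<star> A)" "j < dim_col (u \<star> A)"
    then have rj: "r = 0" "j < n" using A by (auto simp: mat_prod_def u_def)
    have "(u \<star> A) $$ (0, j) =
        sum_up_to (\<lambda>k. (if k = i then e else z) * A $$ (k, j)) (m - 1)"
      using A rj i by (subst mat_prod_index; auto simp: u_def intro!: sum_up_to_cong)
    also have "\<dots> = (if i = i then e else z) * A $$ (i, j)"
      using i rj ze by (intro sum_up_to_eq_single) auto
    finally show "mat 1 n (\<lambda>(_, j). A $$ (i, j)) $$ (r, j) = (u \<star> A) $$ (r, j)"
      using rj i ze by simp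
  qed (use A in \<open>auto simp: mat_prod_def u_def\<close>)
  moreover have "u \<in> carrier_mat 1 (dim_row A)" using A by (simp add: u_def)
  ultimately show ?thesis unfolding Row_def by blast
qed

lemma col_in_Col:
  fixes A :: "'a::local_identity_semiring mat"
  assumes A: "A \<in> carrier_mat m n" and "m > 0" and j: "j < n"
  shows "mat m 1 (\<lambda>(i, _). A $$ (i, j)) \<in> Col A"
proof -
  from j have "n > 0" by simp
  from mat_local_identities [OF A \<open>m > 0\<close> this] obtain z e where ze:
    "\<And>i j k l. i < m \<Longrightarrow> j < n \<Longrightarrow> k < m \<Longrightarrow> l < n \<Longrightarrow>
       A $$ (i, j) + A $$ (k, l) * z = A $$ (i, j) \<and> A $$ (i, j) * e = A $$ (i, j)"
    by metis
  define v where "v = mat n 1 (\<lambda>(k, _). if k = j then e else z)"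
  have "mat m 1 (\<lambda>(i, _). A $$ (i, j)) = A \<star> v"
  proof (rule eq_matI)
    fix i c assume "i < dim_row (A \<star> v)" "c < dim_col (A \<star> v)"
    then have ic: "i < m" "c = 0" using A by (auto simp: mat_prod_def v_def)
    have "(A \<star> v) $$ (i, 0) =
        sum_up_to (\<lambda>k. A $$ (i, k) * (if k = j then e else z)) (n - 1)"
      using A ic j by (subst mat_prod_index; auto simp: v_def intro!: sum_up_to_cong)
    also have "\<dots> = A $$ (i, j) * (if j = j then e else z)"
      using j ic ze by (intro sum_up_to_eq_single) auto
    finally show "mat m 1 (\<lambda>(i, _). A $$ (i, j)) $$ (i, c) = (A \<star> v) $$ (i, c)"
      using ic j ze by simp
  qed (use A in \<open>auto simp: mat_prod_def v_def\<close>)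
  moreover have "v \<in> carrier_mat (dim_col A) 1" using A by (simp add: v_def)
  ultimately show ?thesis unfolding Col_def by blast
qed

section \<open>Kernels of row and column spaces\<close>

lemma Ker_rows_Row_iff:
  fixes A :: "'a::local_identity_semiring mat"
  assumes A: "A \<in> carrier_mat m n" and "m > 0" "n > 0"
    and v: "v \<in> carrier_mat n 1" and v': "v' \<in> carrier_mat n 1"
  shows "(v, v') \<in> Ker_rows n (Row A) \<longleftrightarrow> A \<star> v = A \<star> v'"
proof
  assume "A \<star> v = A \<star> v'"
  then have "(u \<star> A) \<star> v = (u \<star> A) \<star> v'" if "u \<in> carrier_mat 1 m" for u
    using that assms by (simp add: mat_prod_assoc)
  then show "(v, v') \<in> Ker_rows n (Row A)"
    using A v v' by (auto simp: Ker_rows_def Row_def)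
next
  assume ker: "(v, v') \<in> Ker_rows n (Row A)"
  show "A \<star> v = A \<star> v'"
  proof (rule eq_matI)
    fix i j assume "i < dim_row (A \<star> v')" "j < dim_col (A \<star> v')"
    then have ij: "i < m" "j = 0" using A v' by (auto simp: mat_prod_def)
    define x where "x = mat 1 n (\<lambda>(_, j). A $$ (i, j))"
    have entry: "(A \<star> w) $$ (i, 0) = (x \<star> w) $$ (0, 0)" if "w \<in> carrier_mat n 1" for w
      using that A ij \<open>n > 0\<close> by (auto simp: mat_prod_index x_def intro!: sum_up_to_cong)
    have "x \<star> v = x \<star> v'"
      using ker row_in_Row [OF A \<open>n > 0\<close> ij(1)] by (auto simp: Ker_rows_def x_def)
    then show "(A \<star> v) $$ (i, j) = (A \<star> v') $$ (i, j)"
      using entry v v' ij by simp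
  qed (use A v v' in \<open>auto simp: mat_prod_def\<close>)
qed

lemma Ker_cols_Col_iff:
  fixes A :: "'a::local_identity_semiring mat"
  assumes A: "A \<in> carrier_mat m n" and "m > 0" "n > 0"
    and u: "u \<in> carrier_mat 1 m" and u': "u' \<in> carrier_mat 1 m"
  shows "(u, u') \<in> Ker_cols m (Col A) \<longleftrightarrow> u \<star> A = u' \<star> A"
proof
  assume "u \<star> A = u' \<star> A"
  then have "u \<star> (A \<star> v) = u' \<star> (A \<star> v)" if "v \<in> carrier_mat n 1" for v
    using that assms by (simp add: mat_prod_assoc [symmetric])
  then show "(u, u') \<in> Ker_cols m (Col A)"
    using A u u' by (auto simp: Ker_cols_def Col_def)
next
  assume ker: "(u, u') \<in> Ker_cols m (Col A)"
  show "u \<star> A = u' \<star> A"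
  proof (rule eq_matI)
    fix i j assume "i < dim_row (u' \<star> A)" "j < dim_col (u' \<star> A)"
    then have ij: "i = 0" "j < n" using A u' by (auto simp: mat_prod_def)
    define y where "y = mat m 1 (\<lambda>(i, _). A $$ (i, j))"
    have entry: "(w \<star> A) $$ (0, j) = (w \<star> y) $$ (0, 0)" if "w \<in> carrier_mat 1 m" for w
      using that A ij \<open>m > 0\<close> by (auto simp: mat_prod_index y_def intro!: sum_up_to_cong)
    have "u \<star> y = u' \<star> y"
      using ker col_in_Col [OF A \<open>m > 0\<close> ij(2)] by (auto simp: Ker_cols_def y_def)
    then show "(u \<star> A) $$ (i, j) = (u' \<star> A) $$ (i, j)"
      using entry u u' ij by simp
  qed (use A u u' in \<open>auto simp: mat_prod_def\<close>)
qed

lemma self_in_Row: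
  fixes x :: "'a::local_identity_semiring mat"
  assumes "x \<in> carrier_mat 1 n" "n > 0"
  shows "x \<in> Row x"
proof -
  have "mat 1 n (\<lambda>(_, j). x $$ (0, j)) = x"
    using assms by (intro eq_matI) auto
  then show ?thesis using row_in_Row [OF assms, of 0] by simp
qed

lemma self_in_Col:
  fixes y :: "'a::local_identity_semiring mat"
  assumes "y \<in> carrier_mat m 1" "m > 0"
  shows "y \<in> Col y"
proof -
  have "mat m 1 (\<lambda>(i, _). y $$ (i, 0)) = y"
    using assms by (intro eq_matI) auto
  then show ?thesis using col_in_Col [OF assms, of 0] by simp
qed

section \<open>Exactness at a single matrix\<close>

lemma rows_separated_iff_Ker_reflects:
  fixes A :: "'a::local_identity_semiring mat"
  assumes A: "A \<in> carrier_mat m n" and "m > 0" "n > 0"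
  shows "(\<forall>x \<in> carrier_mat 1 n - Row A.
           \<exists>v \<in> carrier_mat n 1. \<exists>v' \<in> carrier_mat n 1. A \<star> v = A \<star> v' \<and> x \<star> v \<noteq> x \<star> v') \<longleftrightarrow>
         (\<forall>p>0. \<forall>B \<in> carrier_mat p n.
           Ker_rows n (Row A) \<subseteq> Ker_rows n (Row B) \<longrightarrow> Row B \<subseteq> Row A)"
    (is "?E \<longleftrightarrow> ?F")
proof
  assume E: ?E
  show ?F
  proof (intro allI ballI impI subsetI)
    fix p B x
    assume B: "B \<in> carrier_mat p n" and sub: "Ker_rows n (Row A) \<subseteq> Ker_rows n (Row B)"
      and x: "x \<in> Row B"
    have "x \<in> carrier_mat 1 n" using x B by (auto simp: Row_def)
    moreover have "x \<star> v = x \<star> v'"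
      if "v \<in> carrier_mat n 1" "v' \<in> carrier_mat n 1" "A \<star> v = A \<star> v'" for v v'
    proof -
      have "(v, v') \<in> Ker_rows n (Row B)"
        using sub that Ker_rows_Row_iff [OF assms] by blast
      then show ?thesis using x by (auto simp: Ker_rows_def)
    qed
    ultimately show "x \<in> Row A" using E by blast
  qed
next
  assume F: ?F
  show ?E
  proof
    fix x assume x: "x \<in> carrier_mat 1 n - Row A"
    then have "\<not> Row x \<subseteq> Row A" using self_in_Row \<open>n > 0\<close> by blast
    then have "\<not> Ker_rows n (Row A) \<subseteq> Ker_rows n (Row x)"
      using F [rule_format, of 1 x] x by auto
    then obtain v v' where ker: "(v, v') \<in> Ker_rows n (Row A)" "(v, v') \<notin> Ker_rows n (Row x)"
      by auto
    then have vv': "v \<in> carrier_mat n 1" "v' \<in> carrier_mat n 1"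
      by (auto simp: Ker_rows_def)
    have "A \<star> v = A \<star> v'" "x \<star> v \<noteq> x \<star> v'"
      using ker Ker_rows_Row_iff [OF assms vv'] Ker_rows_Row_iff [of x 1 n v v'] x vv' \<open>n > 0\<close>
      by auto
    then show "\<exists>v \<in> carrier_mat n 1. \<exists>v' \<in> carrier_mat n 1. A \<star> v = A \<star> v' \<and> x \<star> v \<noteq> x \<star> v'"
      using vv' by blast
  qed
qed

lemma cols_separated_iff_Ker_reflects:
  fixes A :: "'a::local_identity_semiring mat"
  assumes A: "A \<in> carrier_mat m n" and "m > 0" "n > 0"
  shows "(\<forall>y \<in> carrier_mat m 1 - Col A.
           \<exists>u \<in> carrier_mat 1 m. \<exists>u' \<in> carrier_mat 1 m. u \<star> A = u' \<star> A \<and> u \<star> y \<noteq> u' \<star> y) \<longleftrightarrow>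
         (\<forall>q>0. \<forall>B \<in> carrier_mat m q.
           Ker_cols m (Col A) \<subseteq> Ker_cols m (Col B) \<longrightarrow> Col B \<subseteq> Col A)"
    (is "?E \<longleftrightarrow> ?F")
proof
  assume E: ?E
  show ?F
  proof (intro allI ballI impI subsetI)
    fix q B y
    assume B: "B \<in> carrier_mat m q" and sub: "Ker_cols m (Col A) \<subseteq> Ker_cols m (Col B)"
      and y: "y \<in> Col B"
    have "y \<in> carrier_mat m 1" using y B by (auto simp: Col_def)
    moreover have "u \<star> y = u' \<star> y"
      if "u \<in> carrier_mat 1 m" "u' \<in> carrier_mat 1 m" "u \<star> A = u' \<star> A" for u u'
    proof -
      have "(u, u') \<in> Ker_cols m (Col B)"
        using sub that Ker_cols_Col_iff [OF assms] by blast
      then show ?thesis using y by (auto simp: Ker_cols_def)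
    qed
    ultimately show "y \<in> Col A" using E by blast
  qed
next
  assume F: ?F
  show ?E
  proof
    fix y assume y: "y \<in> carrier_mat m 1 - Col A"
    then have "\<not> Col y \<subseteq> Col A" using self_in_Col \<open>m > 0\<close> by blast
    then have "\<not> Ker_cols m (Col A) \<subseteq> Ker_cols m (Col y)"
      using F [rule_format, of 1 y] y by auto
    then obtain u u' where ker: "(u, u') \<in> Ker_cols m (Col A)" "(u, u') \<notin> Ker_cols m (Col y)"
      by auto
    then have uu': "u \<in> carrier_mat 1 m" "u' \<in> carrier_mat 1 m"
      by (auto simp: Ker_cols_def)
    have "u \<star> A = u' \<star> A" "u \<star> y \<noteq> u' \<star> y"
      using ker Ker_cols_Col_iff [OF assms uu'] Ker_cols_Col_iff [of y m 1 u u'] y uu' \<open>m > 0\<close>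
      by auto
    then show "\<exists>u \<in> carrier_mat 1 m. \<exists>u' \<in> carrier_mat 1 m. u \<star> A = u' \<star> A \<and> u \<star> y \<noteq> u' \<star> y"
      using uu' by blast
  qed
qed

theorem theorem3p2:
  "exact TYPE('a::local_identity_semiring) \<longleftrightarrow>
     (\<forall>m>0. \<forall>n>0. \<forall>A \<in> (carrier_mat m n :: 'a mat set).
        (\<forall>p>0. \<forall>B \<in> carrier_mat p n.
           Ker_rows n (Row A) \<subseteq> Ker_rows n (Row B) \<longrightarrow> Row B \<subseteq> Row A) \<and>
        (\<forall>q>0. \<forall>B \<in> carrier_mat m q.
           Ker_cols m (Col A) \<subseteq> Ker_cols m (Col B) \<longrightarrow> Col B \<subseteq> Col A))"
  unfolding exact_def
  by (intro all_cong ball_cong refl conj_cong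
        rows_separated_iff_Ker_reflects cols_separated_iff_Ker_reflects)

end
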